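(* Let $p$ be a prime, $\mathcal{E}$ a finite family of linear equations over $\mathbb{F}_p$ (as in the context), and $A\subseteq\mathbb{F}_p$ a set avoiding $\mathcal{E}$. There is an absolute constant $c_0>0$ such that the following hold. (1) If $|A|\ge c_0p^{39/47}$, then for every $\kappa_1<\frac{10}{31}$ one has $|A|\le C(\kappa_1)\,p/\mathcal{T}(\mathcal{E})^{\kappa_1}$, and for every $\kappa_2<\frac{3}{10}$ one has $|A|\le C(\kappa_2)\,p/\mathcal{T}_*(\mathcal{E})^{\kappa_2}$, where $C(\kappa)$ depends only on $\kappa$. (2) If $|A|\ge c_0p^{7/9}$ and $\mathcal{T}_*(\mathcal{E})<p^{2/3}$, then for every $\kappa_3<\frac{35}{159}$, $$|A|\le C(\kappa_3)\max\Big\{\frac{p}{\mathcal{T}_*(\mathcal{E})^{\kappa_3}}\Big(\frac{\mathsf{E}^+_*(A)}{|A|^3}\Big)^{22/159},\ \frac{p}{\mathcal{T}_*(\mathcal{E})^{69/183}}\Big\}.$$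
   Context: A family $\mathcal{E}$ consists of $n=|\mathcal{E}|$ equations $a_jx+b_jy+c_jz=d_j$ with $a_j,b_j,c_j\in\mathbb{F}_p^*$, $d_j\in\mathbb{F}_p$, no two coefficient triples proportional. $A$ avoids $\mathcal{E}$ if there are no $j$ and $x,y,z\in A$ with $a_jx+b_jy+c_jz=d_j$. For $k\in\{1,2,3\}$ divide each triple $(a_j,b_j,c_j)$ by its $k$-th coordinate and record the remaining two coordinates as a point $(u^{(k)}_j,v^{(k)}_j)$. $\mathcal{T}(\mathcal{E})=\max_k$ of the maximal size of $J\subseteq\{1,\dots,n\}$ with the $u^{(k)}_j$ ($j\in J$) pairwise distinct and the $v^{(k)}_j$ ($j\in J$) pairwise distinct. $\mathcal{T}_*(\mathcal{E})=\max_k$ of the maximal size of $J$ such that every $j\in J$ has $u^{(k)}_j\neq u^{(k)}_i$ for all $i\in J\setminus\{j\}$, or $v^{(k)}_j\neq v^{(k)}_i$ for all $i\in J\setminus\{j\}$, or $u^{(k)}_j/v^{(k)}_j\neq u^{(k)}_i/v^{(k)}_i$ for all $i\in J\setminus\{j\}$. $\mathsf{E}^+(A)=|\{(a_1,a_2,a_3,a_4)\in A^4: a_1+a_2=a_3+a_4\}|$ and $\mathsf{E}^+_*(A)=\mathsf{E}^+(A)-|A|^4/p$. *)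

theory Defs
  imports Complex_Main "HOL-Number_Theory.Residues"
begin

text \<open>
  Since the constants of the theorem are uniform in the prime \<open>p\<close>, the field of \<open>p\<close> elements
  is the ring \<open>residue_ring p\<close> with carrier \<open>{0..p - 1}\<close> rather than a type.
\<close>

abbreviation Fp :: "nat \<Rightarrow> int ring"
  where "Fp p \<equiv> residue_ring (int p)"

definition fdiv :: "nat \<Rightarrow> int \<Rightarrow> int \<Rightarrow> int"
  where "fdiv p x y = x \<otimes>\<^bsub>Fp p\<^esub> inv\<^bsub>Fp p\<^esub> y"

text \<open>The tuple \<open>(a, b, c, d)\<close> stands for the equation \<open>a x + b y + c z = d\<close>.\<close>

type_synonym lin_eq = "int \<times> int \<times> int \<times> int"

definition solves :: "nat \<Rightarrow> lin_eq \<Rightarrow> int \<Rightarrow> int \<Rightarrow> int \<Rightarrow> bool"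
  where "solves p e x y z \<longleftrightarrow> (case e of (a, b, c, d) \<Rightarrow>
    a \<otimes>\<^bsub>Fp p\<^esub> x \<oplus>\<^bsub>Fp p\<^esub> b \<otimes>\<^bsub>Fp p\<^esub> y \<oplus>\<^bsub>Fp p\<^esub> c \<otimes>\<^bsub>Fp p\<^esub> z = d)"

definition proportional :: "nat \<Rightarrow> lin_eq \<Rightarrow> lin_eq \<Rightarrow> bool"
  where "proportional p e e' \<longleftrightarrow> (case (e, e') of ((a, b, c, d), (a', b', c', d')) \<Rightarrow>
    (\<exists>t \<in> carrier (Fp p) - {\<zero>\<^bsub>Fp p\<^esub>}.
      a' = t \<otimes>\<^bsub>Fp p\<^esub> a \<and> b' = t \<otimes>\<^bsub>Fp p\<^esub> b \<and> c' = t \<otimes>\<^bsub>Fp p\<^esub> c))"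

text \<open>A family of \<open>n\<close> equations is indexed by \<open>{1..n}\<close>; values of \<open>E\<close> elsewhere are irrelevant.\<close>

definition eq_family :: "nat \<Rightarrow> nat \<Rightarrow> (nat \<Rightarrow> lin_eq) \<Rightarrow> bool"
  where "eq_family p n E \<longleftrightarrow>
    (\<forall>j \<in> {1..n}. case E j of (a, b, c, d) \<Rightarrow>
      a \<in> carrier (Fp p) - {\<zero>\<^bsub>Fp p\<^esub>} \<and> b \<in> carrier (Fp p) - {\<zero>\<^bsub>Fp p\<^esub>} \<and>
      c \<in> carrier (Fp p) - {\<zero>\<^bsub>Fp p\<^esub>} \<and> d \<in> carrier (Fp p)) \<and>
    (\<forall>i \<in> {1..n}. \<forall>j \<in> {1..n}. i \<noteq> j \<longrightarrow> \<not> proportional p (E i) (E j))"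

definition avoids :: "nat \<Rightarrow> nat \<Rightarrow> (nat \<Rightarrow> lin_eq) \<Rightarrow> int set \<Rightarrow> bool"
  where "avoids p n E A \<longleftrightarrow>
    \<not> (\<exists>j \<in> {1..n}. \<exists>x \<in> A. \<exists>y \<in> A. \<exists>z \<in> A. solves p (E j) x y z)"

text \<open>The remaining two coordinates are kept in their original order; only \<open>k \<in> {1, 2, 3}\<close> is used.\<close>

definition norm_point :: "nat \<Rightarrow> nat \<Rightarrow> lin_eq \<Rightarrow> int \<times> int"
  where "norm_point p k e = (case e of (a, b, c, d) \<Rightarrow>
    if k = 1 then (fdiv p b a, fdiv p c a)
    else if k = 2 then (fdiv p a b, fdiv p c b)
    else (fdiv p a c, fdiv p b c))"

definition ucoord :: "nat \<Rightarrow> nat \<Rightarrow> lin_eq \<Rightarrow> int"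
  where "ucoord p k e = fst (norm_point p k e)"

definition vcoord :: "nat \<Rightarrow> nat \<Rightarrow> lin_eq \<Rightarrow> int"
  where "vcoord p k e = snd (norm_point p k e)"

definition T_size :: "nat \<Rightarrow> nat \<Rightarrow> (nat \<Rightarrow> lin_eq) \<Rightarrow> nat"
  where "T_size p n E = Max ((\<lambda>k. Max (card ` {J. J \<subseteq> {1..n} \<and>
      inj_on (\<lambda>j. ucoord p k (E j)) J \<and> inj_on (\<lambda>j. vcoord p k (E j)) J})) ` {1, 2, 3})"

definition T_star :: "nat \<Rightarrow> nat \<Rightarrow> (nat \<Rightarrow> lin_eq) \<Rightarrow> nat"
  where "T_star p n E = Max ((\<lambda>k. Max (card ` {J. J \<subseteq> {1..n} \<and>
      (\<forall>j \<in> J.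
        (\<forall>i \<in> J - {j}. ucoord p k (E j) \<noteq> ucoord p k (E i)) \<or>
        (\<forall>i \<in> J - {j}. vcoord p k (E j) \<noteq> vcoord p k (E i)) \<or>
        (\<forall>i \<in> J - {j}. fdiv p (ucoord p k (E j)) (vcoord p k (E j))
                       \<noteq> fdiv p (ucoord p k (E i)) (vcoord p k (E i))))})) ` {1, 2, 3})"

definition add_energy :: "nat \<Rightarrow> int set \<Rightarrow> nat"
  where "add_energy p A = card {(a1, a2, a3, a4).
    a1 \<in> A \<and> a2 \<in> A \<and> a3 \<in> A \<and> a4 \<in> A \<and> a1 \<oplus>\<^bsub>Fp p\<^esub> a2 = a3 \<oplus>\<^bsub>Fp p\<^esub> a4}"

definition add_energy_star :: "nat \<Rightarrow> int set \<Rightarrow> real"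
  where "add_energy_star p A = real (add_energy p A) - real (card A) ^ 4 / real p"

end

theory Submission
  imports Defs "HOL-Library.Real_Mod" "HOL-Analysis.Convex"
begin

text \<open>
  Let \<open>\<delta> = |A| / p\<close> and let \<open>f\<close> be the modulus of the Fourier transform of \<open>A\<close>. An avoided equation
  gives \<open>|A|\<^sup>3 \<le> \<Sum>\<^bsub>r \<noteq> 0\<^esub> f(a r) f(b r) f(c r)\<close>, hence \<open>|A|\<^sup>5 \<le> p \<Sum>\<^bsub>r \<noteq> 0\<^esub> f(a r)\<^sup>2 f(b r)\<^sup>2\<close> by
  Cauchy--Schwarz and Parseval. Over equations with pairwise distinct ratios \<open>b / a\<close> the right-hand
  sides add up to at most \<open>p (p |A|)\<^sup>2\<close>, so there are at most \<open>\<delta>\<^bsup>-3\<^esup>\<close> such equations. This yields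
  the exponent 1/3, larger than 10/31 and 3/10. The same inequality for a single equation gives \<open>\<delta>\<^sup>2 \<le> \<omega>\<close> for the normalised energy
  \<open>\<omega> = E\<^sub>*(A) / |A|\<^sup>3 \<le> 1\<close>. Interpolating the two bounds proves part (2), where the first term
  of the maximum already suffices.
\<close>

section \<open>Additive characters modulo \<open>p\<close> and the Fourier transform of a
  set\<close>

definition chi :: "nat \<Rightarrow> int \<Rightarrow> complex"
  where "chi p m = cis (2 * pi * of_int m / of_nat p)"

text \<open>Unnormalised and indexed by all integers, since frequencies occur as unreduced products
  such as \<open>a * r\<close>; \<open>spec_cong\<close> handles their reduction modulo
  \<open>p\<close>.\<close>

definition fourier :: "nat \<Rightarrow> int set \<Rightarrow> int \<Rightarrow> complex"
  where "fourier p A r = (\<Sum>a\<in>A. chi p (r * a))"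

abbreviation spec :: "nat \<Rightarrow> int set \<Rightarrow> int \<Rightarrow> real"
  where "spec p A r \<equiv> norm (fourier p A r)"

lemma chi_add: "chi p (a + b) = chi p a * chi p b"
  by (simp add: chi_def cis_mult add_divide_distrib distrib_left)

lemma chi_uminus: "chi p (- a) = cnj (chi p a)"
  by (simp add: chi_def cis_cnj)

lemma norm_chi [simp]: "norm (chi p a) = 1"
  by (simp add: chi_def)

lemma chi_0 [simp]: "chi p 0 = 1"
  by (simp add: chi_def)

lemma chi_power: "chi p (int k * a) = chi p a ^ k"
  by (induction k) (simp_all add: chi_add distrib_right)

lemma chi_eq_1_iff:
  assumes "p > 0"
  shows "chi p m = 1 \<longleftrightarrow> int p dvd m"
proof -
  have "chi p m = 1 \<longleftrightarrow> (\<exists>n. 2 * pi * of_int m / of_nat p = of_int n * (2 * pi))"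
    by (simp add: chi_def cis_eq_1_iff)
  also have "\<dots> \<longleftrightarrow> (\<exists>n. real_of_int m = real_of_int (int p * n))"
    using assms by (simp add: field_simps)
  also have "\<dots> \<longleftrightarrow> int p dvd m"
    by (simp only: of_int_eq_iff dvd_def)
  finally show ?thesis .
qed

lemma chi_mult_cong:
  assumes "p > 0" "[r = s] (mod int p)"
  shows "chi p (r * a) = chi p (s * a)"
proof -
  have "int p dvd r * a - s * a"
    using assms(2) by (metis cong_iff_dvd_diff dvd_mult2 left_diff_distrib)
  then have "chi p (s * a + (r * a - s * a)) = chi p (s * a)"
    unfolding chi_add using chi_eq_1_iff[OF assms(1)] by simp
  then show ?thesis by simp
qed

lemma spec_cong:
  assumes "p > 0" "[r = s] (mod int p)"
  shows "spec p A r = spec p A s"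
  unfolding fourier_def using chi_mult_cong[OF assms] by simp

lemma fourier_0 [simp]: "fourier p A 0 = of_nat (card A)"
  by (simp add: fourier_def)

text \<open>Orthogonality: a geometric sum of powers of \<open>chi p m\<close>, a
  \<open>p\<close>-th root of unity that equals 1 exactly when \<open>p\<close> divides
  \<open>m\<close>.\<close>

lemma sum_chi:
  assumes "p > 0"
  shows "(\<Sum>r\<in>{0..<int p}. chi p (r * m)) = (if int p dvd m then of_nat p else 0)"
proof -
  have "(\<Sum>r\<in>{0..<int p}. chi p (r * m)) = (\<Sum>k<p. chi p (int k * m))"
    by (rule sum.reindex_bij_witness[where i = int and j = nat]) auto
  also have "\<dots> = (\<Sum>k<p. chi p m ^ k)"
    by (simp add: chi_power)
  also have "\<dots> = (if int p dvd m then of_nat p else 0)"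
  proof (cases "int p dvd m")
    case True
    then have "chi p m = 1" using chi_eq_1_iff[OF assms] by simp
    then show ?thesis using True by simp
  next
    case False
    then have "chi p m \<noteq> 1" using chi_eq_1_iff[OF assms] by simp
    moreover have "chi p m ^ p = 1"
      using chi_eq_1_iff[OF assms, of "int p * m"] by (simp add: chi_power)
    ultimately show ?thesis using False by (simp add: sum_gp_strict)
  qed
  finally show ?thesis .
qed

text \<open>Orthogonality as a counting device. It is applied to differences of pairs (Parseval), to
  quadruples (additive energy) and to solutions of a linear equation.\<close>

lemma sum_chi_count:
  assumes "p > 0" "finite I"
  shows "(\<Sum>r\<in>{0..<int p}. \<Sum>i\<in>I. chi p (r * g i)) = of_nat (p * card {i \<in> I. int p dvd g i})"
proof -
  have "(\<Sum>r\<in>{0..<int p}. \<Sum>i\<in>I. chi p (r * g i)) =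
      (\<Sum>i\<in>I. if int p dvd g i then of_nat p else 0)"
    by (subst sum.swap) (simp add: sum_chi[OF assms(1)])
  also have "\<dots> = of_nat (p * card {i \<in> I. int p dvd g i})"
    using assms(2) by (subst sum.inter_filter[symmetric]) simp_all
  finally show ?thesis .
qed

section \<open>Dilations and moments over the nonzero frequencies\<close>

lemma sum_residues_split:
  assumes "p > 0"
  shows "(\<Sum>r\<in>{0..<int p}. h r) = h 0 + (\<Sum>r\<in>{1..<int p}. h r)"
proof -
  have "{0..<int p} = insert 0 {1..<int p}" using assms by auto
  then show ?thesis by simp
qed

text \<open>Since \<open>p\<close> is prime, \<open>a\<close> is invertible and multiplication by it
  permutes the nonzero residues. This is the change of variables behind all later dilation
  steps.\<close>

lemma bij_betw_mult_residues:
  assumes "prime p" "a \<in> {1..<int p}"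
  shows "bij_betw (\<lambda>r. a * r mod int p) {1..<int p} {1..<int p}"
proof -
  have p: "prime (int p)" using assms(1) by simp
  have cop: "coprime a (int p)"
    using p assms(2) by (metis atLeastLessThan_iff coprime_commute not_less prime_imp_coprime
        zdvd_imp_le zero_less_one order_less_le_trans)
  have "inj_on (\<lambda>r. a * r mod int p) {1..<int p}"
  proof (rule inj_onI)
    fix x y assume xy: "x \<in> {1..<int p}" "y \<in> {1..<int p}" "a * x mod int p = a * y mod int p"
    then have "[a * x = a * y] (mod int p)" by (simp add: cong_def)
    then have "[x = y] (mod int p)" using cop by (simp add: cong_mult_lcancel)
    then show "x = y" using xy by (simp add: cong_def)
  qed
  moreover have "(\<lambda>r. a * r mod int p) ` {1..<int p} \<subseteq> {1..<int p}"
  proof clarify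
    fix r assume r: "r \<in> {1..<int p}"
    have "\<not> int p dvd a" "\<not> int p dvd r" using r assms(2) by (auto dest: zdvd_imp_le)
    then have "a * r mod int p \<noteq> 0" using p by (simp add: prime_dvd_mult_iff dvd_eq_mod_eq_0[symmetric])
    moreover have "0 \<le> a * r mod int p" "a * r mod int p < int p" using r by auto
    ultimately show "a * r mod int p \<in> {1..<int p}" by auto
  qed
  ultimately show ?thesis
    by (simp add: bij_betw_def endo_inj_surj)
qed

lemma sum_spec_dilate:
  assumes "prime p" "a \<in> {1..<int p}"
  shows "(\<Sum>r\<in>{1..<int p}. spec p A (a * r) ^ k) = (\<Sum>r\<in>{1..<int p}. spec p A r ^ k)"
proof -
  have p: "p > 0" using assms(1) by (rule prime_gt_0_nat)
  have "(\<Sum>r\<in>{1..<int p}. spec p A r ^ k) = (\<Sum>r\<in>{1..<int p}. spec p A (a * r mod int p) ^ k)"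
    by (rule sum.reindex_bij_betw[OF bij_betw_mult_residues[OF assms], symmetric])
  also have "\<dots> = (\<Sum>r\<in>{1..<int p}. spec p A (a * r) ^ k)"
    by (intro sum.cong refl arg_cong[where f = "\<lambda>x. x ^ k"] spec_cong[OF p]) (simp add: cong_def)
  finally show ?thesis by simp
qed

lemma residues_diff_dvd:
  assumes "A \<subseteq> {0..<int p}" "x \<in> A" "y \<in> A" "int p dvd x - y"
  shows "x = y"
proof -
  have "x mod int p = y mod int p" using assms(4) by (simp add: mod_eq_dvd_iff)
  then show ?thesis using assms(1-3) by (simp add: subset_iff)
qed

text \<open>Expanding the square counts pairs from \<open>A\<close> congruent modulo
  \<open>p\<close>; as \<open>A\<close> consists of reduced residues, these are the diagonal
  pairs.\<close>

lemma parseval: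
  assumes "p > 0" "A \<subseteq> {0..<int p}"
  shows "(\<Sum>r\<in>{0..<int p}. spec p A r ^ 2) = real p * real (card A)"
proof -
  have fin: "finite A" using assms(2) finite_subset by blast
  have "complex_of_real (spec p A r ^ 2) = (\<Sum>i\<in>A \<times> A. chi p (r * (fst i - snd i)))" for r
    unfolding complex_norm_square fourier_def cnj_sum sum_product sum.cartesian_product
    by (simp add: case_prod_beta right_diff_distrib chi_uminus[symmetric] chi_add[symmetric])
  then have "complex_of_real (\<Sum>r\<in>{0..<int p}. spec p A r ^ 2) =
      of_nat (p * card {i \<in> A \<times> A. int p dvd fst i - snd i})"
    using sum_chi_count[OF assms(1), of "A \<times> A" "\<lambda>i. fst i - snd i"] fin by simp
  moreover have "{i \<in> A \<times> A. int p dvd fst i - snd i} = (\<lambda>a. (a, a)) ` A"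
    by (auto simp: image_iff intro: residues_diff_dvd[OF assms(2), symmetric])
  moreover have "card ((\<lambda>a. (a, a)) ` A) = card A"
    by (rule card_image) (simp add: inj_on_def)
  ultimately have "complex_of_real (\<Sum>r\<in>{0..<int p}. spec p A r ^ 2) =
      complex_of_real (real p * real (card A))"
    by simp
  then show ?thesis unfolding of_real_eq_iff .
qed

lemma sum_spec_square_le:
  assumes "p > 0" "A \<subseteq> {0..<int p}"
  shows "(\<Sum>r\<in>{1..<int p}. spec p A r ^ 2) \<le> real p * real (card A)"
  using parseval[OF assms] sum_residues_split[OF assms(1), of "\<lambda>r. spec p A r ^ 2"]
    zero_le_power2[of "spec p A 0"] by linarith

lemma residue_ring_eqs:
  assumes "prime p"
  shows "carrier (Fp p) = {0..<int p}" "\<zero>\<^bsub>Fp p\<^esub> = 0"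
    "x \<oplus>\<^bsub>Fp p\<^esub> y = (x + y) mod int p" "x \<otimes>\<^bsub>Fp p\<^esub> y = x * y mod int p"
proof -
  interpret residues_prime p "Fp p" by unfold_locales (use assms in simp_all)
  show "carrier (Fp p) = {0..<int p}" "\<zero>\<^bsub>Fp p\<^esub> = 0"
    "x \<oplus>\<^bsub>Fp p\<^esub> y = (x + y) mod int p" "x \<otimes>\<^bsub>Fp p\<^esub> y = x * y mod int p"
    by (auto simp: res_carrier_eq res_zero_eq res_add_eq res_mult_eq)
qed

text \<open>The fourth moment over all frequencies is \<open>p\<close> times the additive energy.
  Dropping frequency 0 removes \<open>|A|^4\<close>, which is exactly the correction in
  \<open>add_energy_star\<close>.\<close>

lemma sum_spec_fourth:
  assumes "prime p" "A \<subseteq> {0..<int p}"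
  shows "(\<Sum>r\<in>{1..<int p}. spec p A r ^ 4) = real p * add_energy_star p A"
proof -
  have p: "p > 0" using assms(1) by (rule prime_gt_0_nat)
  have fin: "finite A" using assms(2) finite_subset by blast
  define g :: "(int \<times> int) \<times> int \<times> int \<Rightarrow> int"
    where "g = (\<lambda>((a1, a2), (a3, a4)). a1 + a2 - (a3 + a4))"
  let ?I = "(A \<times> A) \<times> (A \<times> A)"
  have sq: "fourier p A r ^ 2 = (\<Sum>i\<in>A \<times> A. chi p (r * (fst i + snd i)))" for r
    unfolding fourier_def power2_eq_square sum_product sum.cartesian_product
    by (simp add: case_prod_beta distrib_left chi_add)
  have "complex_of_real (spec p A r ^ 4) = (\<Sum>i\<in>?I. chi p (r * g i))" for r
  proof -
    have "complex_of_real (spec p A r ^ 4) = complex_of_real (norm (fourier p A r ^ 2) ^ 2)"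
      by (simp add: norm_power flip: power_mult)
    also have "\<dots> = (\<Sum>i\<in>?I. chi p (r * g i))"
      unfolding complex_norm_square sq cnj_sum sum_product sum.cartesian_product
      by (simp add: case_prod_beta g_def right_diff_distrib chi_uminus[symmetric] chi_add[symmetric])
    finally show ?thesis .
  qed
  then have "complex_of_real (\<Sum>r\<in>{0..<int p}. spec p A r ^ 4) =
      of_nat (p * card {i \<in> ?I. int p dvd g i})"
    using sum_chi_count[OF p, of ?I g] fin by simp
  also have "card {i \<in> ?I. int p dvd g i} = add_energy p A"
    unfolding add_energy_def
    by (rule bij_betw_same_card[where f = "\<lambda>((a1, a2), (a3, a4)). (a1, a2, a3, a4)"],
        rule bij_betw_byWitness[where f' = "\<lambda>(a1, a2, a3, a4). ((a1, a2), (a3, a4))"])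
      (auto simp: g_def residue_ring_eqs[OF assms(1)] mod_eq_dvd_iff)
  finally have "complex_of_real (\<Sum>r\<in>{0..<int p}. spec p A r ^ 4) =
      complex_of_real (real p * real (add_energy p A))"
    by simp
  then have "(\<Sum>r\<in>{0..<int p}. spec p A r ^ 4) = real p * real (add_energy p A)"
    unfolding of_real_eq_iff .
  then show ?thesis
    using p sum_residues_split[OF p, of "\<lambda>r. spec p A r ^ 4"]
    by (simp add: add_energy_star_def right_diff_distrib)
qed

text \<open>Three entries of an additive quadruple determine the fourth. This later bounds the
  normalised energy by 1.\<close>

lemma add_energy_le:
  assumes "prime p" "A \<subseteq> {0..<int p}"
  shows "add_energy p A \<le> card A ^ 3"
proof -
  have fin: "finite A" using assms(2) finite_subset by blast
  let ?S = "{(a1, a2, a3, a4). a1 \<in> A \<and> a2 \<in> A \<and> a3 \<in> A \<and> a4 \<in> A \<and>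
    a1 \<oplus>\<^bsub>Fp p\<^esub> a2 = a3 \<oplus>\<^bsub>Fp p\<^esub> a4}"
  have eq: "d = d'" if "d \<in> A" "d' \<in> A" and
      "a \<oplus>\<^bsub>Fp p\<^esub> b = c \<oplus>\<^bsub>Fp p\<^esub> d" "a \<oplus>\<^bsub>Fp p\<^esub> b = c \<oplus>\<^bsub>Fp p\<^esub> d'" for a b c d d'
  proof -
    have "int p dvd d - d'"
      using that(3,4) dvd_diff[of "int p" "a + b - (c + d')" "a + b - (c + d)"]
      by (simp add: residue_ring_eqs[OF assms(1)] mod_eq_dvd_iff)
    then show ?thesis using residues_diff_dvd[OF assms(2) that(1,2)] by simp
  qed
  have "inj_on (\<lambda>(a1, a2, a3, a4). (a1, a2, a3)) ?S"
    by (rule inj_onI) (auto intro: eq)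
  then have "card ?S = card ((\<lambda>(a1, a2, a3, a4). (a1, a2, a3)) ` ?S)"
    by (simp add: card_image)
  also have "\<dots> \<le> card (A \<times> A \<times> A)"
    by (rule card_mono) (use fin in auto)
  also have "\<dots> = card A ^ 3"
    by (simp add: card_cartesian_product power3_eq_cube)
  finally show ?thesis unfolding add_energy_def .
qed

section \<open>Spectral sums forced to be large by avoided equations\<close>

text \<open>The number of solutions of \<open>a x + b y + c z = d\<close> in \<open>A\<close> is a character sum whose zero
  frequency contributes \<open>|A|\<^sup>3\<close>; if there are no solutions, the other frequencies cancel it.\<close>

lemma card_cube_le_spec:
  assumes "p > 0" "A \<subseteq> {0..<int p}"
    and "\<And>x y z. \<lbrakk>x \<in> A; y \<in> A; z \<in> A\<rbrakk> \<Longrightarrow> \<not> int p dvd a * x + b * y + c * z - d"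
  shows "real (card A) ^ 3 \<le>
    (\<Sum>r\<in>{1..<int p}. spec p A (a * r) * spec p A (b * r) * spec p A (c * r))"
proof -
  have fin: "finite A" using assms(2) finite_subset by blast
  define g where "g = (\<lambda>((x, y), z). a * x + b * y + c * z - d)"
  \<comment> \<open>The last factor encodes the right-hand side \<open>d\<close>; it has modulus 1
    and disappears once norms are taken.\<close>
  define h where "h r = fourier p A (a * r) * fourier p A (b * r) * fourier p A (c * r) *
    chi p (- (r * d))" for r
  let ?I = "(A \<times> A) \<times> A"
  have "h r = (\<Sum>i\<in>?I. chi p (r * g i))" for r
    unfolding h_def fourier_def sum_product sum.cartesian_product
    unfolding sum_distrib_right
    by (simp add: case_prod_beta g_def chi_add[symmetric] algebra_simps)
  moreover have "{i \<in> ?I. int p dvd g i} = {}"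
    using assms(3) by (auto simp: g_def)
  ultimately have "(\<Sum>r\<in>{0..<int p}. h r) = 0"
    using sum_chi_count[OF assms(1), of ?I g] fin by simp
  then have "h 0 = - (\<Sum>r\<in>{1..<int p}. h r)"
    using sum_residues_split[OF assms(1), of h] by (simp add: eq_neg_iff_add_eq_0)
  then have "norm (h 0) \<le> (\<Sum>r\<in>{1..<int p}. norm (h r))"
    by (simp add: norm_sum)
  moreover have "norm (h 0) = real (card A) ^ 3"
    by (simp add: h_def norm_mult power3_eq_cube)
  ultimately show ?thesis by (simp add: h_def norm_mult)
qed

text \<open>Cauchy--Schwarz, with the third factor removed by Parseval.\<close>

lemma card_power5_le_spec:
  assumes "prime p" "A \<subseteq> {0..<int p}" "A \<noteq> {}" "c \<in> {1..<int p}"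
    and "\<And>x y z. \<lbrakk>x \<in> A; y \<in> A; z \<in> A\<rbrakk> \<Longrightarrow> \<not> int p dvd a * x + b * y + c * z - d"
  shows "real (card A) ^ 5 \<le>
    real p * (\<Sum>r\<in>{1..<int p}. spec p A (a * r) ^ 2 * spec p A (b * r) ^ 2)"
proof -
  have p: "p > 0" using assms(1) by (rule prime_gt_0_nat)
  have fin: "finite A" using assms(2) finite_subset by blast
  let ?S = "\<Sum>r\<in>{1..<int p}. spec p A (a * r) ^ 2 * spec p A (b * r) ^ 2"
  have "(real (card A) ^ 3) ^ 2 \<le>
      (\<Sum>r\<in>{1..<int p}. (spec p A (a * r) * spec p A (b * r)) * spec p A (c * r)) ^ 2"
    using card_cube_le_spec[OF p assms(2,5)] by (intro power_mono) auto
  also have "\<dots> \<le> (\<Sum>r\<in>{1..<int p}. (spec p A (a * r) * spec p A (b * r)) ^ 2) *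
      (\<Sum>r\<in>{1..<int p}. spec p A (c * r) ^ 2)"
    by (rule Cauchy_Schwarz_ineq_sum)
  also have "\<dots> \<le> ?S * (real p * real (card A))"
    using sum_spec_square_le[OF p assms(2)] sum_spec_dilate[OF assms(1,4), of A 2]
    by (intro mult_mono) (auto simp: power_mult_distrib intro!: sum_nonneg)
  \<comment> \<open>The left side is a sixth power of \<open>card A\<close>; one factor is matched
    by Parseval and cancels.\<close>
  finally have "real (card A) ^ 5 * real (card A) \<le> (real p * ?S) * real (card A)"
    by (simp add: algebra_simps flip: power_mult power_Suc)
  moreover have "real (card A) > 0" using fin assms(3) by (simp add: card_gt_0_iff)
  ultimately show ?thesis by simp
qed

text \<open>The arithmetic-geometric mean inequality splits each product of squares into fourth
  powers, and both dilated fourth moments equal \<open>p\<close> times the energy.\<close>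

lemma energy_lower_bound:
  assumes "prime p" "A \<subseteq> {0..<int p}" "A \<noteq> {}"
    and "a \<in> {1..<int p}" "b \<in> {1..<int p}" "c \<in> {1..<int p}"
    and "\<And>x y z. \<lbrakk>x \<in> A; y \<in> A; z \<in> A\<rbrakk> \<Longrightarrow> \<not> int p dvd a * x + b * y + c * z - d"
  shows "real (card A) ^ 5 \<le> real p ^ 2 * add_energy_star p A"
proof -
  have *: "x ^ 2 * y ^ 2 \<le> (x ^ 4 + y ^ 4) / 2" for x y :: real
    using sum_squares_bound[of "x ^ 2" "y ^ 2"] by (simp flip: power_mult)
  have "(\<Sum>r\<in>{1..<int p}. spec p A (a * r) ^ 2 * spec p A (b * r) ^ 2) \<le>
      (\<Sum>r\<in>{1..<int p}. (spec p A (a * r) ^ 4 + spec p A (b * r) ^ 4) / 2)"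
    by (intro sum_mono *)
  also have "\<dots> = real p * add_energy_star p A"
    using sum_spec_dilate[OF assms(1,4), of A 4] sum_spec_dilate[OF assms(1,5), of A 4]
      sum_spec_fourth[OF assms(1,2)]
    by (simp add: sum.distrib flip: sum_divide_distrib)
  finally have "real p * (\<Sum>r\<in>{1..<int p}. spec p A (a * r) ^ 2 * spec p A (b * r) ^ 2) \<le>
      real p * (real p * add_energy_star p A)"
    by (intro mult_left_mono) auto
  with card_power5_le_spec[OF assms(1,2,3,6,7)] show ?thesis
    by (simp add: power2_eq_square mult.assoc)
qed

text \<open>Distinct ratios make the pairs \<open>(r, \<mu> j r)\<close> distinct, so the sums over \<open>r\<close> for different \<open>j\<close>
  are disjoint parts of the double sum over all pairs of frequencies.\<close>

lemma card_distinct_ratios_le: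
  assumes "prime p" "A \<subseteq> {0..<int p}" "A \<noteq> {}" "finite J"
    and "\<And>j. j \<in> J \<Longrightarrow> s j \<in> {1..<int p}" "\<And>j. j \<in> J \<Longrightarrow> \<mu> j \<in> {1..<int p}"
    and ratio: "\<And>j. j \<in> J \<Longrightarrow> [\<mu> j * s j = t j] (mod int p)" and inj: "inj_on \<mu> J"
    and large: "\<And>j. j \<in> J \<Longrightarrow> real (card A) ^ 5 \<le>
      real p * (\<Sum>r\<in>{1..<int p}. spec p A (s j * r) ^ 2 * spec p A (t j * r) ^ 2)"
  shows "real (card J) \<le> (real p / real (card A)) ^ 3"
proof -
  have p: "p > 0" using assms(1) by (rule prime_gt_0_nat)
  have fin: "finite A" using assms(2) finite_subset by blast
  let ?N = "real (card A)" and ?P = "{1..<int p}"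
  have N: "?N > 0" using fin assms(3) by (simp add: card_gt_0_iff)
  \<comment> \<open>Taking \<open>s j * r\<close> as the new variable makes the first factor
    independent of \<open>j\<close>, so that it can leave the sum over \<open>j\<close>.\<close>
  have dil: "(\<Sum>r\<in>?P. spec p A (s j * r) ^ 2 * spec p A (t j * r) ^ 2) =
      (\<Sum>r\<in>?P. spec p A r ^ 2 * spec p A (r * \<mu> j mod int p) ^ 2)" if "j \<in> J" for j
  proof -
    have eq: "spec p A (s j * r mod int p) = spec p A (s j * r)"
      "spec p A (s j * r mod int p * \<mu> j mod int p) = spec p A (t j * r)" for r
    proof -
      show "spec p A (s j * r mod int p) = spec p A (s j * r)"
        by (rule spec_cong[OF p]) (simp add: cong_def)
      have "[s j * r * \<mu> j = t j * r] (mod int p)"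
        using cong_scalar_right[OF ratio[OF that], of r] by (simp add: ac_simps)
      then show "spec p A (s j * r mod int p * \<mu> j mod int p) = spec p A (t j * r)"
        by (intro spec_cong[OF p]) (simp add: cong_def mod_mult_left_eq)
    qed
    show ?thesis
      using sum.reindex_bij_betw[OF bij_betw_mult_residues[OF assms(1) assms(5)[OF that]],
          of "\<lambda>r. spec p A r ^ 2 * spec p A (r * \<mu> j mod int p) ^ 2"]
      by (simp only: eq)
  qed
  have "real (card J) * ?N ^ 5 = (\<Sum>j\<in>J. ?N ^ 5)" by simp
  also have "\<dots> \<le> (\<Sum>j\<in>J. real p * (\<Sum>r\<in>?P. spec p A r ^ 2 * spec p A (r * \<mu> j mod int p) ^ 2))"
    using large by (intro sum_mono) (simp add: dil)
  also have "\<dots> = real p * (\<Sum>r\<in>?P. spec p A r ^ 2 * (\<Sum>j\<in>J. spec p A (r * \<mu> j mod int p) ^ 2))"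
    by (simp add: sum_distrib_left sum.swap[where A = J and B = ?P])
  also have "\<dots> \<le> real p * (\<Sum>r\<in>?P. spec p A r ^ 2 * (real p * ?N))"
  proof (intro mult_left_mono sum_mono)
    \<comment> \<open>For fixed \<open>r\<close> the residues \<open>r * \<mu> j\<close> are
      distinct and nonzero, so the sum over \<open>j\<close> is part of the Parseval sum.\<close>
    fix r assume r: "r \<in> ?P"
    have bij: "bij_betw (\<lambda>x. r * x mod int p) ?P ?P" by (rule bij_betw_mult_residues[OF assms(1) r])
    have sub: "\<mu> ` J \<subseteq> ?P" using assms(6) by auto
    have "inj_on (\<lambda>j. r * \<mu> j mod int p) J"
      using comp_inj_on[OF inj, of "\<lambda>x. r * x mod int p"] inj_on_subset[OF bij_betw_imp_inj_on[OF bij] sub]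
      by (simp add: comp_def)
    then have "(\<Sum>j\<in>J. spec p A (r * \<mu> j mod int p) ^ 2) =
        (\<Sum>q\<in>(\<lambda>j. r * \<mu> j mod int p) ` J. spec p A q ^ 2)"
      by (simp add: sum.reindex)
    also have "\<dots> \<le> (\<Sum>q\<in>?P. spec p A q ^ 2)"
      using bij_betwE[OF bij] sub by (intro sum_mono2) auto
    also have "\<dots> \<le> real p * ?N" by (rule sum_spec_square_le[OF p assms(2)])
    finally show "(\<Sum>j\<in>J. spec p A (r * \<mu> j mod int p) ^ 2) \<le> real p * ?N" .
  qed auto
  also have "\<dots> = real p * ((\<Sum>r\<in>?P. spec p A r ^ 2) * (real p * ?N))"
    by (simp add: sum_distrib_right)
  also have "\<dots> \<le> real p * ((real p * ?N) * (real p * ?N))"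
    using sum_spec_square_le[OF p assms(2)] by (intro mult_left_mono mult_right_mono) auto
  also have "\<dots> = real p ^ 3 * ?N ^ 2" by (simp add: eval_nat_numeral)
  finally have "(real (card J) * ?N ^ 3) * ?N ^ 2 \<le> real p ^ 3 * ?N ^ 2"
    by (simp add: mult.assoc flip: power_add)
  then have "real (card J) * ?N ^ 3 \<le> real p ^ 3" using N by simp
  then show ?thesis using N by (simp add: power_divide pos_le_divide_eq)
qed

section \<open>Coefficient ratios and normalised points\<close>

lemma fdiv_residue:
  assumes "prime p" "x \<in> {1..<int p}" "y \<in> {1..<int p}"
  shows "fdiv p x y \<in> {1..<int p}" "[fdiv p x y * y = x] (mod int p)"
proof -
  interpret residues_prime p "Fp p" by unfold_locales (use assms(1) in simp_all)
  have "{1..int (p - 1)} = {1..<int p}" using prime_gt_0_nat[OF assms(1)] by auto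
  then have U: "Units (Fp p) = {1..<int p}" using res_prime_units_eq by simp
  have xy: "x \<in> Units (Fp p)" "y \<in> Units (Fp p)" unfolding U by (rule assms)+
  then show "fdiv p x y \<in> {1..<int p}" unfolding fdiv_def U[symmetric] by simp
  have "fdiv p x y \<otimes>\<^bsub>Fp p\<^esub> y = x" unfolding fdiv_def
    by (metis Units_closed Units_inv_closed Units_l_inv m_assoc r_one xy)
  then show "[fdiv p x y * y = x] (mod int p)"
    using assms(2) by (simp add: res_mult_eq cong_def)
qed

text \<open>The common denominator \<open>z\<close> cancels, so the quotient of the two normalised
  coordinates is again a ratio of two coefficients.\<close>

lemma fdiv_fdiv_cong:
  assumes "prime p" "x \<in> {1..<int p}" "y \<in> {1..<int p}" "z \<in> {1..<int p}"
  shows "[fdiv p (fdiv p x z) (fdiv p y z) * y = x] (mod int p)"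
proof -
  let ?u = "fdiv p x z" and ?v = "fdiv p y z"
  let ?w = "fdiv p ?u ?v"
  have u: "?u \<in> {1..<int p}" "[?u * z = x] (mod int p)" using fdiv_residue assms by auto
  have v: "?v \<in> {1..<int p}" "[?v * z = y] (mod int p)" using fdiv_residue assms by auto
  have "[?w * y = ?w * (?v * z)] (mod int p)" using v(2) by (simp add: cong_scalar_left cong_sym)
  also have "[?w * (?v * z) = ?u * z] (mod int p)"
    using cong_scalar_right[OF fdiv_residue(2)[OF assms(1) u(1) v(1)], of z] by (simp add: mult.assoc)
  also note u(2)
  finally show ?thesis .
qed

text \<open>All three variables range over the same set \<open>A\<close>, so permuting the
  coefficients preserves avoidance. Every normalisation thus takes one form, with \<open>z\<close>
  as the divisor.\<close>

lemma norm_point_equation: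
  assumes "prime p" "A \<subseteq> {0..<int p}" "eq_family p n E" "avoids p n E A" "j \<in> {1..n}"
  shows "\<exists>x y z d. x \<in> {1..<int p} \<and> y \<in> {1..<int p} \<and> z \<in> {1..<int p} \<and>
    ucoord p k (E j) = fdiv p x z \<and> vcoord p k (E j) = fdiv p y z \<and>
    (\<forall>X\<in>A. \<forall>Y\<in>A. \<forall>Z\<in>A. \<not> int p dvd x * X + y * Y + z * Z - d)"
proof -
  obtain a b c d where e: "E j = (a, b, c, d)" by (cases "E j")
  have *: "{0..<int p} - {0} = {1..<int p}" by auto
  have abc: "a \<in> {1..<int p}" "b \<in> {1..<int p}" "c \<in> {1..<int p}" "d \<in> {0..<int p}"
    using assms(3,5) e unfolding eq_family_def residue_ring_eqs[OF assms(1)] * by fastforce+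
  have no: "\<not> int p dvd a * X + b * Y + c * Z - d" if "X \<in> A" "Y \<in> A" "Z \<in> A" for X Y Z
  proof
    assume "int p dvd a * X + b * Y + c * Z - d"
    then have "(a * X + b * Y + c * Z) mod int p = d"
      using abc(4) by (simp flip: mod_eq_dvd_iff)
    then have "solves p (E j) X Y Z"
      by (simp add: solves_def e residue_ring_eqs[OF assms(1)] mod_simps)
    with assms(4,5) that show False unfolding avoids_def by blast
  qed
  \<comment> \<open>\<open>norm_point\<close> divides by the third coefficient for every
    \<open>k\<close> other than 1 and 2, which the last case mirrors.\<close>
  consider "k = 1" | "k = 2" | "k \<noteq> 1" "k \<noteq> 2" by blast
  then show ?thesis
  proof cases
    case 1
    have "\<forall>X\<in>A. \<forall>Y\<in>A. \<forall>Z\<in>A. \<not> int p dvd b * X + c * Y + a * Z - d"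
      using no by (metis add.commute add.assoc)
    with 1 abc show ?thesis
      by (intro exI[of _ b] exI[of _ c] exI[of _ a] exI[of _ d])
        (simp add: ucoord_def vcoord_def norm_point_def e)
  next
    case 2
    have "\<forall>X\<in>A. \<forall>Y\<in>A. \<forall>Z\<in>A. \<not> int p dvd a * X + c * Y + b * Z - d"
      using no by (metis add.commute add.assoc)
    with 2 abc show ?thesis
      by (intro exI[of _ a] exI[of _ c] exI[of _ b] exI[of _ d])
        (simp add: ucoord_def vcoord_def norm_point_def e)
  next
    case 3
    with abc no show ?thesis
      by (intro exI[of _ a] exI[of _ b] exI[of _ c] exI[of _ d])
        (simp add: ucoord_def vcoord_def norm_point_def e)
  qed
qed

text \<open>Each of the three quantities is a ratio of two coefficients. The remaining coefficient
  is the one eliminated by Parseval, after which distinct ratios can be counted.\<close>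

lemma card_inj_coords_le:
  assumes "prime p" "A \<subseteq> {0..<int p}" "A \<noteq> {}" "eq_family p n E" "avoids p n E A"
    and J: "J \<subseteq> {1..n}"
    and inj: "inj_on (\<lambda>j. ucoord p k (E j)) J \<or> inj_on (\<lambda>j. vcoord p k (E j)) J \<or>
      inj_on (\<lambda>j. fdiv p (ucoord p k (E j)) (vcoord p k (E j))) J"
  shows "real (card J) \<le> (real p / real (card A)) ^ 3"
proof -
  let ?P = "{1..<int p}"
  have finJ: "finite J" using J finite_subset by blast
  have "\<forall>j\<in>J. \<exists>x y z d. x \<in> ?P \<and> y \<in> ?P \<and> z \<in> ?P \<and>
      ucoord p k (E j) = fdiv p x z \<and> vcoord p k (E j) = fdiv p y z \<and>
      (\<forall>X\<in>A. \<forall>Y\<in>A. \<forall>Z\<in>A. \<not> int p dvd x * X + y * Y + z * Z - d)"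
    using norm_point_equation[OF assms(1,2,4,5)] J by blast
  then obtain x y z d where P: "\<And>j. j \<in> J \<Longrightarrow> x j \<in> ?P" "\<And>j. j \<in> J \<Longrightarrow> y j \<in> ?P"
      "\<And>j. j \<in> J \<Longrightarrow> z j \<in> ?P"
    and u: "\<And>j. j \<in> J \<Longrightarrow> ucoord p k (E j) = fdiv p (x j) (z j)"
    and v: "\<And>j. j \<in> J \<Longrightarrow> vcoord p k (E j) = fdiv p (y j) (z j)"
    and no: "\<And>j X Y Z. \<lbrakk>j \<in> J; X \<in> A; Y \<in> A; Z \<in> A\<rbrakk> \<Longrightarrow>
      \<not> int p dvd x j * X + y j * Y + z j * Z - d j"
    unfolding bchoice_iff by blast
  \<comment> \<open>In each reordering the denominator of the ratio comes first, its numerator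
    second, and the coefficient to be eliminated last.\<close>
  have no1: "\<not> int p dvd z j * X + x j * Y + y j * Z - d j"
    and no2: "\<not> int p dvd z j * X + y j * Y + x j * Z - d j"
    and no3: "\<not> int p dvd y j * X + x j * Y + z j * Z - d j"
    if "j \<in> J" "X \<in> A" "Y \<in> A" "Z \<in> A" for j X Y Z
    using no[OF that(1,3,4,2)] no[OF that(1,4,3,2)] no[OF that(1,3,2,4)] by (simp_all add: ac_simps)
  note bound = card_distinct_ratios_le[OF assms(1-3) finJ]
  note large = card_power5_le_spec[OF assms(1-3)]
  from inj consider "inj_on (\<lambda>j. ucoord p k (E j)) J" | "inj_on (\<lambda>j. vcoord p k (E j)) J"
    | "inj_on (\<lambda>j. fdiv p (ucoord p k (E j)) (vcoord p k (E j))) J" by blast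
  then show ?thesis
  proof cases
    case 1
    show ?thesis
    proof (rule bound[OF P(3) _ _ 1])
      fix j assume j: "j \<in> J"
      show "ucoord p k (E j) \<in> ?P" "[ucoord p k (E j) * z j = x j] (mod int p)"
        using fdiv_residue[OF assms(1) P(1)[OF j] P(3)[OF j]] by (simp_all add: u[OF j])
      show "real (card A) ^ 5 \<le>
          real p * (\<Sum>r\<in>?P. spec p A (z j * r) ^ 2 * spec p A (x j * r) ^ 2)" by (rule large[OF P(2)[OF j] no1[OF j]])
    qed
  next
    case 2
    show ?thesis
    proof (rule bound[OF P(3) _ _ 2])
      fix j assume j: "j \<in> J"
      show "vcoord p k (E j) \<in> ?P" "[vcoord p k (E j) * z j = y j] (mod int p)"
        using fdiv_residue[OF assms(1) P(2)[OF j] P(3)[OF j]] by (simp_all add: v[OF j])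
      show "real (card A) ^ 5 \<le>
          real p * (\<Sum>r\<in>?P. spec p A (z j * r) ^ 2 * spec p A (y j * r) ^ 2)" by (rule large[OF P(1)[OF j] no2[OF j]])
    qed
  next
    case 3
    show ?thesis
    proof (rule bound[OF P(2) _ _ 3])
      fix j assume j: "j \<in> J"
      show "fdiv p (ucoord p k (E j)) (vcoord p k (E j)) \<in> ?P"
        using fdiv_residue(1)[OF assms(1)] P j by (simp add: u v)
      show "[fdiv p (ucoord p k (E j)) (vcoord p k (E j)) * y j = x j] (mod int p)"
        using fdiv_fdiv_cong[OF assms(1) P[OF j]] by (simp add: u[OF j] v[OF j])
      show "real (card A) ^ 5 \<le>
          real p * (\<Sum>r\<in>?P. spec p A (y j * r) ^ 2 * spec p A (x j * r) ^ 2)" by (rule large[OF P(3)[OF j] no3[OF j]])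
    qed
  qed
qed

section \<open>Upper bounds for \<open>T_size\<close> and \<open>T_star\<close>\<close>

text \<open>Extracts an extremal \<open>J\<close> from the nested maxima. The member
  \<open>{1..m}\<close> makes each inner family nonempty and gives the lower bound.\<close>

lemma Max_card_attained:
  assumes "finite K" "K \<noteq> {}" "\<And>k. k \<in> K \<Longrightarrow> F k \<subseteq> Pow {1..n}" "\<And>k. k \<in> K \<Longrightarrow> {1..m} \<in> F k"
  shows "\<exists>k J. J \<in> F k \<and> card J = Max ((\<lambda>k. Max (card ` F k)) ` K) \<and>
    m \<le> Max ((\<lambda>k. Max (card ` F k)) ` K)"
proof -
  have "Max ((\<lambda>k. Max (card ` F k)) ` K) \<in> (\<lambda>k. Max (card ` F k)) ` K"
    using assms(1,2) by (intro Max_in) auto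
  then obtain k where k: "k \<in> K" "Max ((\<lambda>k. Max (card ` F k)) ` K) = Max (card ` F k)"
    by blast
  have fin: "finite (F k)" using assms(3)[OF k(1)] finite_subset by blast
  then have "Max (card ` F k) \<in> card ` F k" using assms(4)[OF k(1)] by (intro Max_in) auto
  then obtain J where J: "J \<in> F k" "card J = Max (card ` F k)" by force
  have "card {1..m} \<le> Max (card ` F k)"
    using fin by (intro Max_ge finite_imageI imageI assms(4)[OF k(1)])
  then show ?thesis using J k(2) by auto
qed

text \<open>Injectivity of the first coordinate on an extremal \<open>J\<close> supplies distinct
  ratios. The lower bound comes from the singleton \<open>{1..1}\<close> and later allows different
  exponents to be compared.\<close>

lemma T_size_bounds:
  assumes "prime p" "A \<subseteq> {0..<int p}" "A \<noteq> {}" "eq_family p n E" "avoids p n E A" "n \<ge> 1"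
  shows "1 \<le> T_size p n E" "real (T_size p n E) \<le> (real p / real (card A)) ^ 3"
proof -
  define F where "F = (\<lambda>k. {J. J \<subseteq> {1..n} \<and>
      inj_on (\<lambda>j. ucoord p k (E j)) J \<and> inj_on (\<lambda>j. vcoord p k (E j)) J})"
  have T: "T_size p n E = Max ((\<lambda>k. Max (card ` F k)) ` {1, 2, 3})"
    unfolding T_size_def F_def ..
  have F: "F k \<subseteq> Pow {1..n}" "{1..1} \<in> F k" for k
    using assms(6) unfolding F_def by auto
  have "\<exists>k J. J \<in> F k \<and> card J = T_size p n E \<and> 1 \<le> T_size p n E"
    unfolding T by (rule Max_card_attained, simp, simp, rule F, rule F)
  then obtain k J where J: "J \<in> F k" "card J = T_size p n E" "1 \<le> T_size p n E"
    by blast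
  from J(3) show "1 \<le> T_size p n E" .
  from J(1) have "J \<subseteq> {1..n}" "inj_on (\<lambda>j. ucoord p k (E j)) J" by (simp_all add: F_def)
  from card_inj_coords_le[OF assms(1-5) this(1) disjI1[OF this(2)]]
  show "real (T_size p n E) \<le> (real p / real (card A)) ^ 3" using J(2) by simp
qed

lemma inj_on_unique_values: "inj_on f {j \<in> J. \<forall>i\<in>J - {j}. f j \<noteq> f i}"
  by (rule inj_onI) auto

text \<open>An extremal \<open>J\<close> is covered by three subsets, according to which of the two
  coordinates or their quotient is unique at \<open>j\<close>. That quantity is injective on its
  subset, whence the factor 3.\<close>

lemma T_star_bounds:
  assumes "prime p" "A \<subseteq> {0..<int p}" "A \<noteq> {}" "eq_family p n E" "avoids p n E A" "n \<ge> 1"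
  shows "1 \<le> T_star p n E" "real (T_star p n E) \<le> 3 * (real p / real (card A)) ^ 3"
proof -
  define unique :: "(nat \<Rightarrow> int) \<Rightarrow> nat set \<Rightarrow> nat set"
    where "unique f J = {j \<in> J. \<forall>i\<in>J - {j}. f j \<noteq> f i}" for f J
  define u v w where "u = (\<lambda>k j. ucoord p k (E j))" and "v = (\<lambda>k j. vcoord p k (E j))"
    and "w = (\<lambda>k j. fdiv p (ucoord p k (E j)) (vcoord p k (E j)))"
  define F where "F = (\<lambda>k. {J. J \<subseteq> {1..n} \<and> (\<forall>j \<in> J. (\<forall>i \<in> J - {j}. u k j \<noteq> u k i) \<or>
      (\<forall>i \<in> J - {j}. v k j \<noteq> v k i) \<or> (\<forall>i \<in> J - {j}. w k j \<noteq> w k i))})"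
  have T: "T_star p n E = Max ((\<lambda>k. Max (card ` F k)) ` {1, 2, 3})"
    unfolding T_star_def F_def u_def v_def w_def ..
  have F: "F k \<subseteq> Pow {1..n}" "{1..1} \<in> F k" for k
    using assms(6) unfolding F_def by auto
  have "\<exists>k J. J \<in> F k \<and> card J = T_star p n E \<and> 1 \<le> T_star p n E"
    unfolding T by (rule Max_card_attained, simp, simp, rule F, rule F)
  then obtain k J where J: "J \<in> F k" "card J = T_star p n E" "1 \<le> T_star p n E"
    by blast
  from J(3) show "1 \<le> T_star p n E" .
  have Jn: "J \<subseteq> {1..n}" using J(1) by (simp add: F_def)
  then have "finite J" using finite_subset by blast
  then have fin: "finite (unique f J)" for f by (simp add: unique_def)
  have sub: "unique f J \<subseteq> {1..n}" for f using Jn by (auto simp: unique_def)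
  have inj: "inj_on f (unique f J)" for f unfolding unique_def by (rule inj_on_unique_values)
  have "J \<subseteq> unique (u k) J \<union> (unique (v k) J \<union> unique (w k) J)"
    using J(1) unfolding F_def unique_def by blast
  then have "card J \<le> card (unique (u k) J \<union> (unique (v k) J \<union> unique (w k) J))"
    using fin by (intro card_mono) auto
  also have "\<dots> \<le> card (unique (u k) J) + (card (unique (v k) J) + card (unique (w k) J))"
    by (meson add_left_mono card_Un_le order_trans)
  finally have "real (card J) \<le>
      real (card (unique (u k) J)) + real (card (unique (v k) J)) + real (card (unique (w k) J))"
    by linarith
  moreover note bound = card_inj_coords_le[OF assms(1-5) sub, of k]
  have "real (card (unique (u k) J)) \<le> (real p / real (card A)) ^ 3"
    using inj[of "u k"] by (intro bound) (simp add: u_def)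
  moreover have "real (card (unique (v k) J)) \<le> (real p / real (card A)) ^ 3"
    using inj[of "v k"] by (intro bound) (simp add: v_def)
  moreover have "real (card (unique (w k) J)) \<le> (real p / real (card A)) ^ 3"
    using inj[of "w k"] by (intro bound) (simp add: w_def)
  ultimately show "real (T_star p n E) \<le> 3 * (real p / real (card A)) ^ 3"
    using J(2) by linarith
qed

section \<open>Real exponents and interpolation\<close>

text \<open>A cube root of the bound on \<open>T\<close>. As \<open>T\<close> is at least 1, an
  exponent \<kappa> up to 1/3 can be raised to 1/3, so the constant does not depend on
  \<kappa>.\<close>

lemma le_powr_of_cube_bound:
  fixes N q T \<kappa> :: real
  assumes "N > 0" "q > 0" "T \<ge> 1" "T \<le> 3 * (q / N) ^ 3" "\<kappa> \<le> 1 / 3"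
  shows "N / q \<le> 3 * T powr - \<kappa>"
proof -
  have "T powr \<kappa> \<le> T powr (1 / 3)" using assms(3,5) by (intro powr_mono) auto
  also have "\<dots> \<le> (3 ^ 3 * (q / N) ^ 3) powr (1 / 3)"
  proof (rule powr_mono2)
    \<comment> \<open>The factor 3 is enlarged to a perfect cube to make the root clean.\<close>
    have "3 * (q / N) ^ 3 \<le> 3 ^ 3 * (q / N) ^ 3"
      using assms(1,2) by (intro mult_right_mono) auto
    then show "T \<le> 3 ^ 3 * (q / N) ^ 3" using assms(4) by linarith
  qed (use assms(3) in auto)
  also have "\<dots> = ((3 * (q / N)) powr 3) powr (1 / 3)"
    using assms(1,2) by (simp add: power_mult_distrib del: times_divide_eq_right)
  also have "\<dots> = 3 * (q / N)" unfolding powr_powr using assms(1,2) by simp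
  finally have "T powr \<kappa> \<le> 3 * q / N" by simp
  then show ?thesis using assms(1-3) by (simp add: powr_minus field_simps)
qed

lemma le_powr_of_cube_bound':
  fixes N q T \<kappa> :: real
  assumes "N > 0" "q > 0" "T \<ge> 1" "T \<le> 3 * (q / N) ^ 3" "\<kappa> \<le> 1 / 3"
  shows "N \<le> 3 * (q / T powr \<kappa>)"
  using le_powr_of_cube_bound[OF assms] assms(1-3) by (simp add: powr_minus field_simps)

text \<open>Interpolates \<open>N / q \<le> 3 T\<^bsup>-1/3\<^esup>\<close> and \<open>N / q \<le> \<omega>\<^bsup>1/2\<^esup>\<close> with weights \<open>105/159\<close> and \<open>54/159\<close>.\<close>

lemma le_powr_interpolate:
  fixes N q T \<kappa> \<omega> :: real
  assumes "N > 0" "q > 0" "T \<ge> 1" "T \<le> 3 * (q / N) ^ 3" "(N / q) ^ 2 \<le> \<omega>" "\<omega> \<le> 1"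
    and "\<kappa> \<le> 35 / 159"
  shows "N \<le> 3 * (q / T powr \<kappa> * \<omega> powr (22 / 159))"
proof -
  have \<delta>: "N / q > 0" using assms(1,2) by simp
  have \<omega>: "\<omega> > 0" using \<delta> assms(5) by (meson less_le_trans zero_less_power)
  have "N / q = (N / q) powr (105 / 159) * (N / q) powr (54 / 159)"
    using assms(1,2) by (simp flip: powr_add)
  also have "\<dots> \<le> (3 * T powr - \<kappa>) * \<omega> powr (22 / 159)"
  proof (rule mult_mono)
    have "(N / q) powr (105 / 159) \<le> (3 * T powr - (1 / 3)) powr (105 / 159)"
      using le_powr_of_cube_bound[OF assms(1-4), of "1 / 3"] \<delta> by (intro powr_mono2) auto
    also have "\<dots> = 3 powr (105 / 159) * T powr - (35 / 159)"
      by (simp add: powr_mult powr_powr)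
    also have "\<dots> \<le> 3 powr 1 * T powr - \<kappa>"
      using assms(3,7) by (intro mult_mono powr_mono) auto
    finally show "(N / q) powr (105 / 159) \<le> 3 * T powr - \<kappa>" by simp
    have "(N / q) powr (54 / 159) = ((N / q) powr 2) powr (27 / 159)"
      by (simp add: powr_powr)
    also have "\<dots> \<le> \<omega> powr (27 / 159)"
      using assms(5) \<delta> by (intro powr_mono2) auto
    \<comment> \<open>Lowering the exponent from 27/159 to 22/159 is allowed because \<omega> lies
      between 0 and 1.\<close>
    also have "\<dots> \<le> \<omega> powr (22 / 159)"
      using \<omega> assms(6) by (intro powr_mono') auto
    finally show "(N / q) powr (54 / 159) \<le> \<omega> powr (22 / 159)" .
  qed auto
  finally have "N \<le> q * (3 * T powr - \<kappa> * \<omega> powr (22 / 159))"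
    using assms(2) by (simp add: pos_divide_le_eq mult.commute)
  then show ?thesis by (simp add: powr_minus_divide mult_ac)
qed

theorem theorem31:
  shows "\<exists>c0::real. c0 > 0 \<and> (\<exists>C :: real \<Rightarrow> real.
    \<forall>(p::nat) (n::nat) (E :: nat \<Rightarrow> lin_eq) (A :: int set).
      prime p \<and> n \<ge> 1 \<and> eq_family p n E \<and> A \<subseteq> carrier (Fp p) \<and> avoids p n E A \<longrightarrow>
      (real (card A) \<ge> c0 * real p powr (39/47) \<longrightarrow>
        (\<forall>\<kappa>1 < 10/31. real (card A) \<le> C \<kappa>1 * (real p / real (T_size p n E) powr \<kappa>1)) \<and>
        (\<forall>\<kappa>2 < 3/10. real (card A) \<le> C \<kappa>2 * (real p / real (T_star p n E) powr \<kappa>2))) \<and>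
      (real (card A) \<ge> c0 * real p powr (7/9) \<and> real (T_star p n E) < real p powr (2/3) \<longrightarrow>
        (\<forall>\<kappa>3 < 35/159. real (card A) \<le> C \<kappa>3 *
          max (real p / real (T_star p n E) powr \<kappa>3 *
                 (add_energy_star p A / real (card A) ^ 3) powr (22/159))
              (real p / real (T_star p n E) powr (69/183)))))"
proof -
  have main: "(\<forall>\<kappa><10/31. real (card A) \<le> 3 * (real p / real (T_size p n E) powr \<kappa>)) \<and>
      (\<forall>\<kappa><3/10. real (card A) \<le> 3 * (real p / real (T_star p n E) powr \<kappa>)) \<and>
      (\<forall>\<kappa><35/159. real (card A) \<le> 3 * max (real p / real (T_star p n E) powr \<kappa> *
          (add_energy_star p A / real (card A) ^ 3) powr (22/159))
        (real p / real (T_star p n E) powr (69/183)))"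
    if p: "prime p" and n: "n \<ge> 1" and E: "eq_family p n E" and A: "A \<subseteq> carrier (Fp p)"
      and av: "avoids p n E A" for p n :: nat and E A
  proof (cases "A = {}")
    \<comment> \<open>The empty set is treated apart because the estimates divide by
      \<open>card A\<close>; here the left-hand sides are 0.\<close>
    case True
    then show ?thesis by (auto simp: le_max_iff_disj)
  next
    case ne: False
    have A': "A \<subseteq> {0..<int p}" using A residue_ring_eqs(1)[OF p] by simp
    then have fin: "finite A" using finite_subset by blast
    have N: "real (card A) > 0" using ne fin by (simp add: card_gt_0_iff)
    have q: "real p > 0" using prime_gt_0_nat[OF p] by simp
    note size = T_size_bounds[OF p A' ne E av n]
    note star = T_star_bounds[OF p A' ne E av n]
    \<comment> \<open>Weakened by a factor 3 so that \<open>T_size\<close> and \<open>T_star\<close>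
      share the same power estimate.\<close>
    have size': "real (T_size p n E) \<ge> 1" "real (T_size p n E) \<le> 3 * (real p / real (card A)) ^ 3"
      using size N by (auto intro: order_trans[of _ "(real p / real (card A)) ^ 3"])
    have star': "real (T_star p n E) \<ge> 1" using star by simp
    \<comment> \<open>The energy bound is fed by one avoided equation, the first of the
      family.\<close>
    obtain x y z d where eq: "x \<in> {1..<int p}" "y \<in> {1..<int p}" "z \<in> {1..<int p}"
      "\<forall>X\<in>A. \<forall>Y\<in>A. \<forall>Z\<in>A. \<not> int p dvd x * X + y * Y + z * Z - d"
    proof -
      have "1 \<in> {1..n}" using n by simp
      from norm_point_equation[OF p A' E av this, of 1] show ?thesis using that by blast
    qed
    have "real (card A) ^ 5 \<le> real p ^ 2 * add_energy_star p A"
      using energy_lower_bound[OF p A' ne eq(1-3)] eq(4) by blast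
    then have "real (card A) ^ 2 * real (card A) ^ 3 \<le> real p ^ 2 * add_energy_star p A"
      by (simp flip: power_add)
    \<comment> \<open>Division by \<open>p^2 |A|^3\<close> turns the energy bound into a lower bound
      for the normalised energy by the squared density.\<close>
    then have lo: "(real (card A) / real p) ^ 2 \<le> add_energy_star p A / real (card A) ^ 3"
      using N q by (simp add: power_divide divide_le_eq le_divide_eq mult.commute)
    have "add_energy_star p A \<le> real (card A ^ 3)"
      unfolding add_energy_star_def using add_energy_le[OF p A'] q
      by (smt (verit) of_nat_le_iff divide_nonneg_pos zero_le_power of_nat_0_le_iff)
    then have hi: "add_energy_star p A / real (card A) ^ 3 \<le> 1" using N by simp
    show ?thesis
      using le_powr_of_cube_bound'[OF N q size'] le_powr_of_cube_bound'[OF N q star' star(2)]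
        order_trans[OF le_powr_interpolate[OF N q star' star(2) lo hi] mult_left_mono[OF max.cobounded1]]
      by auto
  qed
  show ?thesis
    by (rule exI[of _ 1], rule conjI[OF zero_less_one], rule exI[of _ "\<lambda>_. 3"])
      (use main in blast)
qed

end
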